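(* Let $g$ be a positive integer and $K$ a set of positive integers. If there exists a PBD$(v,K)$ such that for every $k\in K$ there exists a Kirkman frame of type $(g;2g)^k$, then there exists a Kirkman frame of type $(g;2g)^v$.
   Context: A PBD$(v,K)$ is a set of $v$ points with a collection of blocks whose sizes lie in $K$ such that every pair of distinct points lies in exactly one block. A 3-GDD of type $g^u$ on a point set $V$ is a partition of $V$ into $u$ groups of size $g$ together with a set of 3-subsets (blocks) each meeting every group in at most one point, such that any two points in different groups lie in exactly one block. A Kirkman frame is a 3-GDD whose blocks can be partitioned into partial parallel classes, each of which is a partition of $V\setminus V_i$ for some group $V_i$. A Kirkman frame of type $(g;h)^u$ is a Kirkman frame of type $h^u$ (groups $V_1,\dots,V_u$, block set $\mathcal{B}$) together with a 3-GDD of type $g^u$ with groups $W_1,\dots,W_u$ and block set $\mathcal{A}$ such that $W_i\subseteq V_i$ for all $i$ and $\mathcal{A}\subseteq\mathcal{B}$. *)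

theory Defs
  imports Main "HOL-Library.Disjoint_Sets"
begin

definition pbd :: "nat \<Rightarrow> nat set \<Rightarrow> 'a set \<Rightarrow> 'a set set \<Rightarrow> bool" where
  "pbd v K X \<B> \<longleftrightarrow>
     finite X \<and> card X = v \<and>
     (\<forall>B\<in>\<B>. B \<subseteq> X \<and> card B \<in> K) \<and>
     (\<forall>x\<in>X. \<forall>y\<in>X. x \<noteq> y \<longrightarrow> (\<exists>!B. B \<in> \<B> \<and> x \<in> B \<and> y \<in> B))"

text \<open>\<open>gdd3 g u V \<G> \<B>\<close>: a 3-GDD of type \<open>g\<^sup>u\<close> on \<open>V\<close> with set of groups \<open>\<G>\<close> and set of
  blocks \<open>\<B>\<close>. The parts of a \<open>partition_on\<close> are nonempty, so the definition is meant for \<open>g > 0\<close>.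
  Finiteness of \<open>V\<close> is stated explicitly because \<open>card\<close> is 0 on infinite sets.\<close>

definition gdd3 :: "nat \<Rightarrow> nat \<Rightarrow> 'a set \<Rightarrow> 'a set set \<Rightarrow> 'a set set \<Rightarrow> bool" where
  "gdd3 g u V \<G> \<B> \<longleftrightarrow>
     finite V \<and>
     partition_on V \<G> \<and> card \<G> = u \<and> (\<forall>G\<in>\<G>. card G = g) \<and>
     (\<forall>B\<in>\<B>. B \<subseteq> V \<and> card B = 3 \<and> (\<forall>G\<in>\<G>. card (B \<inter> G) \<le> 1)) \<and>
     (\<forall>G\<in>\<G>. \<forall>H\<in>\<G>. G \<noteq> H \<longrightarrow>
        (\<forall>x\<in>G. \<forall>y\<in>H. \<exists>!B. B \<in> \<B> \<and> x \<in> B \<and> y \<in> B))"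

definition kirkman_frame :: "nat \<Rightarrow> nat \<Rightarrow> 'a set \<Rightarrow> 'a set set \<Rightarrow> 'a set set \<Rightarrow> bool" where
  "kirkman_frame h u V \<G> \<B> \<longleftrightarrow>
     gdd3 h u V \<G> \<B> \<and>
     (\<exists>\<P>. partition_on \<B> \<P> \<and> (\<forall>C\<in>\<P>. \<exists>G\<in>\<G>. partition_on (V - G) C))"

text \<open>Type \<open>(g;h)\<^sup>u\<close>: the two sets of groups are enumerated as \<open>V\<^sub>1, \<dots>, V\<^sub>u\<close> and
  \<open>W\<^sub>1, \<dots>, W\<^sub>u\<close> with \<open>W\<^sub>i \<subseteq> V\<^sub>i\<close>.\<close>

definition nested_kirkman_frame ::
  "nat \<Rightarrow> nat \<Rightarrow> nat \<Rightarrow> (nat \<Rightarrow> 'a set) \<Rightarrow> 'a set set \<Rightarrow> (nat \<Rightarrow> 'a set) \<Rightarrow> 'a set set \<Rightarrow> bool" where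
  "nested_kirkman_frame g h u V \<B> W \<A> \<longleftrightarrow>
     inj_on V {1..u} \<and> kirkman_frame h u (\<Union>i\<in>{1..u}. V i) (V ` {1..u}) \<B> \<and>
     inj_on W {1..u} \<and> gdd3 g u (\<Union>i\<in>{1..u}. W i) (W ` {1..u}) \<A> \<and>
     (\<forall>i\<in>{1..u}. W i \<subseteq> V i) \<and> \<A> \<subseteq> \<B>"

text \<open>All designs here are finite, so points may be taken to be natural numbers.\<close>

definition pbd_exists :: "nat \<Rightarrow> nat set \<Rightarrow> bool" where
  "pbd_exists v K \<longleftrightarrow> (\<exists>(X :: nat set) \<B>. pbd v K X \<B>)"

definition nested_kirkman_frame_exists :: "nat \<Rightarrow> nat \<Rightarrow> nat \<Rightarrow> bool" where
  "nested_kirkman_frame_exists g h u \<longleftrightarrow>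
     (\<exists>(V :: nat \<Rightarrow> nat set) \<B> W \<A>. nested_kirkman_frame g h u V \<B> W \<A>)"

end

theory Submission imports Defs "HOL-Library.Nat_Bijection" begin

text \<open>Replace every point \<open>x\<close> of the PBD by a fibre \<open>{x} \<times> {..<2 * g}\<close>, containing
  \<open>{x} \<times> {..<g}\<close>, and put an ingredient frame on the fibres over each block (Wilson's fundamental
  construction). Counting shows that in a Kirkman frame of type \<open>(2g)\<^sup>u\<close> with \<open>u > 1\<close> every group is
  the hole of exactly \<open>g\<close> partial parallel classes. So the classes with hole \<open>x\<close> can be numbered
  by \<open>j < g\<close> in every ingredient, and the union of the \<open>j\<close>-th classes with hole \<open>x\<close>, taken over all
  PBD blocks through \<open>x\<close>, is a partial parallel class with hole \<open>x\<close> of the whole design.\<close>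

section \<open>Designs whose groups are the fibres of a product\<close>

text \<open>Numbering the points of a group by an initial segment makes nesting a matter of
  truncation: for \<open>g \<le> h\<close> the fibre of length \<open>g\<close> over
  \<open>x\<close> lies inside the one of length \<open>h\<close>.\<close>

definition fibres :: "'i set \<Rightarrow> nat \<Rightarrow> ('i \<times> nat) set set" where
  "fibres S h = (\<lambda>x. {x} \<times> {..<h}) ` S"

lemma partition_on_fibres:
  assumes "h > 0" shows "partition_on (S \<times> {..<h}) (fibres S h)"
  using assms by (intro partition_onI) (auto simp: fibres_def disjnt_def)

lemma inj_on_fibres: "h > 0 \<Longrightarrow> inj_on (\<lambda>x. {x} \<times> {..<h::nat}) S"
  by (auto simp: inj_on_def set_eq_iff)

lemma card_fibres: "h > 0 \<Longrightarrow> card (fibres S h) = card S"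
  unfolding fibres_def by (intro card_image inj_on_fibres)

text \<open>Two points share a group exactly when their first coordinates agree. So a block is
  transversal iff \<open>fst\<close> is injective on it, and the set of groups disappears from all
  later arguments about pairs.\<close>

lemma gdd3_fibres_iff:
  assumes "h > 0"
  shows "gdd3 h u (S \<times> {..<h}) (fibres S h) B \<longleftrightarrow>
    finite S \<and> card S = u \<and>
    (\<forall>b\<in>B. b \<subseteq> S \<times> {..<h} \<and> card b = 3 \<and> inj_on fst b) \<and>
    (\<forall>p\<in>S \<times> {..<h}. \<forall>q\<in>S \<times> {..<h}. fst p \<noteq> fst q \<longrightarrow> (\<exists>!b. b \<in> B \<and> p \<in> b \<and> q \<in> b))"
proof -
  have fin: "finite (S \<times> {..<h}) \<longleftrightarrow> finite S"
    using assms by (auto simp: finite_cartesian_product_iff)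
  have crd: "\<forall>G\<in>fibres S h. card G = h"
    by (auto simp: fibres_def card_cartesian_product)
  have meet: "(\<forall>G\<in>fibres S h. card (b \<inter> G) \<le> 1) \<longleftrightarrow> inj_on fst b"
    if b: "b \<subseteq> S \<times> {..<h}" for b
  proof
    assume *: "\<forall>G\<in>fibres S h. card (b \<inter> G) \<le> 1"
    show "inj_on fst b"
    proof (rule inj_onI)
      fix p q assume pq: "p \<in> b" "q \<in> b" "fst p = fst q"
      let ?G = "{fst p} \<times> {..<h}"
      have "?G \<in> fibres S h" using pq b by (auto simp: fibres_def)
      then have "card (b \<inter> ?G) \<le> Suc 0" using * by auto
      moreover have "finite (b \<inter> ?G)" by auto
      moreover have "p \<in> b \<inter> ?G" "q \<in> b \<inter> ?G"
        using pq b by (auto simp: mem_Times_iff)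
      ultimately show "p = q" by (metis card_le_Suc0_iff_eq)
    qed
  next
    assume inj: "inj_on fst b"
    show "\<forall>G\<in>fibres S h. card (b \<inter> G) \<le> 1"
    proof
      fix G assume "G \<in> fibres S h"
      then obtain x where G: "G = {x} \<times> {..<h}" by (auto simp: fibres_def)
      have "finite (b \<inter> G)" using G by auto
      moreover have "\<forall>p\<in>b \<inter> G. \<forall>q\<in>b \<inter> G. p = q"
        using inj_onD[OF inj] G by auto
      ultimately show "card (b \<inter> G) \<le> 1" by (simp add: card_le_Suc0_iff_eq)
    qed
  qed
  have pairs: "(\<forall>G\<in>fibres S h. \<forall>H\<in>fibres S h. G \<noteq> H \<longrightarrow>
        (\<forall>x\<in>G. \<forall>y\<in>H. \<exists>!b. b \<in> B \<and> x \<in> b \<and> y \<in> b)) \<longleftrightarrow>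
     (\<forall>p\<in>S \<times> {..<h}. \<forall>q\<in>S \<times> {..<h}. fst p \<noteq> fst q \<longrightarrow> (\<exists>!b. b \<in> B \<and> p \<in> b \<and> q \<in> b))"
    (is "?L \<longleftrightarrow> ?R")
  proof
    assume L: ?L
    show ?R
    proof (intro ballI impI)
      fix p q assume pq: "p \<in> S \<times> {..<h}" "q \<in> S \<times> {..<h}" "fst p \<noteq> fst q"
      have G: "{fst p} \<times> {..<h} \<in> fibres S h" "{fst q} \<times> {..<h} \<in> fibres S h"
        and mem: "p \<in> {fst p} \<times> {..<h}" "q \<in> {fst q} \<times> {..<h}"
        using pq by (auto simp: fibres_def)
      have "{fst p} \<times> {..<h} \<noteq> {fst q} \<times> {..<h}"
        using mem pq by (metis mem_Times_iff singletonD)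
      from L[rule_format, OF G this mem] show "\<exists>!b. b \<in> B \<and> p \<in> b \<and> q \<in> b" .
    qed
  next
    assume R: ?R
    show ?L
    proof (intro ballI impI)
      fix G H p q assume *: "G \<in> fibres S h" "H \<in> fibres S h" "G \<noteq> H" "p \<in> G" "q \<in> H"
      then have "p \<in> S \<times> {..<h}" "q \<in> S \<times> {..<h}" "fst p \<noteq> fst q"
        by (auto simp: fibres_def)
      with R show "\<exists>!b. b \<in> B \<and> p \<in> b \<and> q \<in> b" by blast
    qed
  qed
  have blocks: "(\<forall>b\<in>B. b \<subseteq> S \<times> {..<h} \<and> card b = 3 \<and> (\<forall>G\<in>fibres S h. card (b \<inter> G) \<le> 1)) \<longleftrightarrow>
     (\<forall>b\<in>B. b \<subseteq> S \<times> {..<h} \<and> card b = 3 \<and> inj_on fst b)"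
    using meet by blast
  show ?thesis
    unfolding gdd3_def blocks pairs fin card_fibres[OF assms] eqTrueI[OF crd]
      eqTrueI[OF partition_on_fibres[OF assms]] simp_thms ..
qed

section \<open>Transport of designs along injections\<close>

lemma partition_on_image:
  assumes "partition_on A P" "inj_on f A"
  shows "partition_on (f ` A) ((`) f ` P)"
proof -
  have "(`) f ` P - {{}} = (`) f ` P" using partition_onD3[OF assms(1)] by auto
  then show ?thesis using partition_on_inj_image[OF assms] by simp
qed

lemma gdd3_image:
  assumes gdd: "gdd3 g u V \<G> B" and inj: "inj_on f V"
  shows "gdd3 g u (f ` V) ((`) f ` \<G>) ((`) f ` B)"
proof -
  have part: "partition_on V \<G>" using gdd by (simp add: gdd3_def)
  have GV: "\<And>G. G \<in> \<G> \<Longrightarrow> G \<subseteq> V" using part by (auto simp: partition_on_def)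
  have BV: "\<And>b. b \<in> B \<Longrightarrow> b \<subseteq> V" using gdd by (auto simp: gdd3_def)
  have pairs: "\<exists>!b. b \<in> B \<and> x \<in> b \<and> y \<in> b"
    if "G \<in> \<G>" "H \<in> \<G>" "G \<noteq> H" "x \<in> G" "y \<in> H" for G H x y
    using gdd that by (simp add: gdd3_def)
  have crd: "\<And>A. A \<subseteq> V \<Longrightarrow> card (f ` A) = card A"
    using inj by (meson card_image inj_on_subset)
  have inj': "inj_on ((`) f) (Pow V)" using inj by (rule inj_on_image_Pow)
  have c\<G>: "card ((`) f ` \<G>) = card \<G>"
    using GV by (intro card_image inj_on_subset[OF inj']) auto
  have meet: "card (f ` b \<inter> f ` G) = card (b \<inter> G)" if "b \<in> B" "G \<in> \<G>" for b G
    using inj_on_image_Int[OF inj BV[OF that(1)] GV[OF that(2)]] crd[of "b \<inter> G"] BV[OF that(1)]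
    by auto
  have pairs': "\<exists>!b. b \<in> (`) f ` B \<and> f x \<in> b \<and> f y \<in> b"
    if GH: "G \<in> \<G>" "H \<in> \<G>" "f ` G \<noteq> f ` H" "x \<in> G" "y \<in> H" for G H x y
  proof -
    have "G \<noteq> H" using GH by blast
    from pairs[OF GH(1,2) this GH(4,5)] obtain b where b: "b \<in> B" "x \<in> b" "y \<in> b"
      and u: "\<And>c. c \<in> B \<Longrightarrow> x \<in> c \<Longrightarrow> y \<in> c \<Longrightarrow> c = b" by blast
    \<comment> \<open>Since blocks lie in \<open>V\<close>, where \<open>f\<close> is injective,
      incidence is reflected as well as preserved; this carries uniqueness of the block over to the
      image.\<close>
    have mem: "f z \<in> f ` c \<longleftrightarrow> z \<in> c" if "c \<in> B" "z \<in> V" for c z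
      using inj_on_image_mem_iff[OF inj that(2) BV[OF that(1)]] .
    have "x \<in> V" "y \<in> V" using GH GV by auto
    show ?thesis
    proof (rule ex1I[of _ "f ` b"])
      show "f ` b \<in> (`) f ` B \<and> f x \<in> f ` b \<and> f y \<in> f ` b" using b by blast
      fix d assume "d \<in> (`) f ` B \<and> f x \<in> d \<and> f y \<in> d"
      then obtain c where c: "c \<in> B" "d = f ` c" "f x \<in> f ` c" "f y \<in> f ` c" by blast
      then have "c = b" using u mem \<open>x \<in> V\<close> \<open>y \<in> V\<close> by simp
      then show "d = f ` b" using c by simp
    qed
  qed
  have blocks: "\<forall>b\<in>(`) f ` B. b \<subseteq> f ` V \<and> card b = 3 \<and> (\<forall>G\<in>(`) f ` \<G>. card (b \<inter> G) \<le> 1)"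
  proof
    fix d assume "d \<in> (`) f ` B"
    then obtain b where b: "b \<in> B" "d = f ` b" by blast
    then have "card b = 3" "\<forall>G\<in>\<G>. card (b \<inter> G) \<le> 1" using gdd by (auto simp: gdd3_def)
    then show "d \<subseteq> f ` V \<and> card d = 3 \<and> (\<forall>G\<in>(`) f ` \<G>. card (d \<inter> G) \<le> 1)"
      using b BV[OF b(1)] crd meet by auto
  qed
  have "finite V" "card \<G> = u" "\<forall>G\<in>\<G>. card G = g" using gdd by (simp_all add: gdd3_def)
  then have "finite (f ` V)" "card ((`) f ` \<G>) = u" "\<forall>G\<in>(`) f ` \<G>. card G = g"
    using c\<G> crd GV by auto
  moreover have "\<forall>G\<in>(`) f ` \<G>. \<forall>H\<in>(`) f ` \<G>. G \<noteq> H \<longrightarrow>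
      (\<forall>x\<in>G. \<forall>y\<in>H. \<exists>!b. b \<in> (`) f ` B \<and> x \<in> b \<and> y \<in> b)"
  proof (intro ballI impI)
    fix G' H' x' y' assume "G' \<in> (`) f ` \<G>" "H' \<in> (`) f ` \<G>" "G' \<noteq> H'" "x' \<in> G'" "y' \<in> H'"
    then obtain G H x y where "G \<in> \<G>" "H \<in> \<G>" "f ` G \<noteq> f ` H" "x \<in> G" "y \<in> H"
      and "x' = f x" "y' = f y" by blast
    then show "\<exists>!b. b \<in> (`) f ` B \<and> x' \<in> b \<and> y' \<in> b" using pairs' by simp
  qed
  ultimately show ?thesis
    unfolding gdd3_def using partition_on_image[OF part inj] blocks by (intro conjI)
qed

text \<open>The map acts on three levels: points, blocks and classes. Injectivity on points lifts to
  injectivity on blocks, so distinct classes stay disjoint, and images commute with removing a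
  group.\<close>

lemma kirkman_frame_image:
  assumes "kirkman_frame h u V \<G> B" and inj: "inj_on f V"
  shows "kirkman_frame h u (f ` V) ((`) f ` \<G>) ((`) f ` B)"
proof -
  obtain P where gdd: "gdd3 h u V \<G> B" and P: "partition_on B P"
    and C: "\<And>C. C \<in> P \<Longrightarrow> \<exists>G\<in>\<G>. partition_on (V - G) C"
    using assms(1) by (auto simp: kirkman_frame_def)
  have GV: "\<And>G. G \<in> \<G> \<Longrightarrow> G \<subseteq> V" using gdd by (auto simp: partition_on_def gdd3_def)
  have "B \<subseteq> Pow V" using gdd by (auto simp: gdd3_def)
  then have "inj_on ((`) f) B" using inj_on_image_Pow[OF inj] inj_on_subset by blast
  then have "partition_on ((`) f ` B) ((`) ((`) f) ` P)"
    using partition_on_image[OF P] by auto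
  moreover have "\<exists>G\<in>(`) f ` \<G>. partition_on (f ` V - G) ((`) f ` C)" if "C \<in> P" for C
  proof -
    from C[OF that] obtain G where G: "G \<in> \<G>" "partition_on (V - G) C" by blast
    have "partition_on (f ` (V - G)) ((`) f ` C)"
      using partition_on_image[OF G(2) inj_on_subset[OF inj]] by auto
    moreover have "f ` (V - G) = f ` V - f ` G"
      using inj_on_image_set_diff[OF inj _ GV[OF G(1)], of V] by auto
    ultimately show ?thesis using G(1) by auto
  qed
  ultimately show ?thesis
    using gdd3_image[OF gdd inj] unfolding kirkman_frame_def by blast
qed

section \<open>Ingredient frames in product coordinates\<close>

text \<open>Map \<open>W\<close> onto \<open>{..<g}\<close> and \<open>V - W\<close> onto
  \<open>{g..<h}\<close> separately, then combine. This straightens a nested pair of groups in one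
  go.\<close>

lemma ex_bij_betw_initial_segments:
  assumes "finite V" "card V = h" "W \<subseteq> V" "card W = g"
  shows "\<exists>f. bij_betw f V {..<h::nat} \<and> f ` W = {..<g}"
proof -
  have gh: "g \<le> h" using assms card_mono by blast
  have fin: "finite W" using assms finite_subset by blast
  obtain a where a: "bij_betw a W {..<g}"
    using fin assms(4) by (metis card_lessThan finite_lessThan finite_same_card_bij)
  have "card (V - W) = card {g..<h}" using assms fin by (simp add: card_Diff_subset)
  then obtain b where b: "bij_betw b (V - W) {g..<h}"
    using assms(1) by (metis finite_Diff finite_atLeastLessThan finite_same_card_bij)
  let ?f = "\<lambda>x. if x \<in> W then a x else b x"
  have 1: "bij_betw ?f W {..<g}" using a by (simp cong: bij_betw_cong)
  have 2: "bij_betw ?f (V - W) {g..<h}"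
    using b by (subst bij_betw_cong[where g = b]) auto
  have "bij_betw ?f (W \<union> (V - W)) ({..<g} \<union> {g..<h})"
    using 1 2 by (rule bij_betw_combine) auto
  moreover have "W \<union> (V - W) = V" "{..<g} \<union> {g..<h} = {..<h}" using assms(3) gh by auto
  ultimately have "bij_betw ?f V {..<h}" by simp
  then show ?thesis using bij_betw_imp_surj_on[OF 1] by blast
qed

text \<open>A point of the \<open>i\<close>-th group gets the coordinates \<open>e i\<close> in
  \<open>S\<close> and its number within the group. Because each numbering sends \<open>W i\<close>
  to an initial segment, the same map \<open>\<phi>\<close> normalises the frame and its subdesign,
  and the inclusion of the block sets survives.\<close>

lemma nested_kirkman_frame_on_fibres:
  assumes ex: "nested_kirkman_frame_exists g h k" and S: "finite S" "card S = k"
  shows "\<exists>B A. kirkman_frame h k (S \<times> {..<h}) (fibres S h) B \<and>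
           gdd3 g k (S \<times> {..<g}) (fibres S g) A \<and> A \<subseteq> B"
proof -
  obtain V :: "nat \<Rightarrow> nat set" and B W A where injV: "inj_on V {1..k}"
    and fr: "kirkman_frame h k (\<Union>i\<in>{1..k}. V i) (V ` {1..k}) B"
    and gdd: "gdd3 g k (\<Union>i\<in>{1..k}. W i) (W ` {1..k}) A"
    and WV: "\<And>i. i \<in> {1..k} \<Longrightarrow> W i \<subseteq> V i" and AB: "A \<subseteq> B"
    using ex unfolding nested_kirkman_frame_exists_def nested_kirkman_frame_def by blast
  obtain e where e: "bij_betw e {1..k} S"
    using S by (metis card_atLeastAtMost diff_Suc_1 finite_atLeastAtMost finite_same_card_bij)
  have frg: "gdd3 h k (\<Union>i\<in>{1..k}. V i) (V ` {1..k}) B" using fr by (simp add: kirkman_frame_def)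
  have finV: "finite (V i)" and cV: "card (V i) = h" and cW: "card (W i) = g"
    if "i \<in> {1..k}" for i
    using that frg gdd by (auto simp: gdd3_def)
  have "\<exists>f. bij_betw f (V i) {..<h} \<and> f ` W i = {..<g}" if "i \<in> {1..k}" for i
    using ex_bij_betw_initial_segments finV cV cW WV that by metis
  then obtain f where f: "\<And>i. i \<in> {1..k} \<Longrightarrow> bij_betw (f i) (V i) {..<h}"
    and fW: "\<And>i. i \<in> {1..k} \<Longrightarrow> f i ` W i = {..<g}" by metis
  \<comment> \<open>Disjointness of the parts speaks of distinct sets; injectivity of
    \<open>V\<close> turns equal sets into equal indices, so the index chosen by \<open>idx\<close>
    is unique.\<close>
  have disj: "i = j" if "i \<in> {1..k}" "j \<in> {1..k}" "p \<in> V i" "p \<in> V j" for i j p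
  proof -
    have "disjoint (V ` {1..k})" using frg by (auto simp: gdd3_def partition_on_def)
    then have "V i = V j" using that unfolding disjoint_def by blast
    then show ?thesis using injV that by (auto dest: inj_onD)
  qed
  define idx where "idx p = (SOME i. i \<in> {1..k} \<and> p \<in> V i)" for p
  have idx: "idx p = i" if "i \<in> {1..k}" "p \<in> V i" for i p
    unfolding idx_def using that disj by (intro some_equality) blast+
  define \<phi> where "\<phi> p = (e (idx p), f (idx p) p)" for p
  have \<phi>: "\<phi> p = (e i, f i p)" if "i \<in> {1..k}" "p \<in> V i" for i p
    using idx[OF that] by (simp add: \<phi>_def)
  have \<phi>V: "\<phi> ` V i = {e i} \<times> {..<h}" if "i \<in> {1..k}" for i
  proof -
    have "\<phi> ` V i = Pair (e i) ` f i ` V i" using \<phi>[OF that] by (auto simp: image_image)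
    then show ?thesis using f[OF that] by (auto simp: bij_betw_def)
  qed
  have \<phi>W: "\<phi> ` W i = {e i} \<times> {..<g}" if "i \<in> {1..k}" for i
  proof -
    have "\<phi> ` W i = Pair (e i) ` f i ` W i"
      unfolding image_image using \<phi>[OF that] WV[OF that] by (intro image_cong) auto
    then show ?thesis using fW[OF that] by auto
  qed
  have inj: "inj_on \<phi> (\<Union>i\<in>{1..k}. V i)"
  proof (rule inj_onI)
    fix p q assume "p \<in> (\<Union>i\<in>{1..k}. V i)" "q \<in> (\<Union>i\<in>{1..k}. V i)" and eq: "\<phi> p = \<phi> q"
    then obtain i j where ij: "i \<in> {1..k}" "p \<in> V i" "j \<in> {1..k}" "q \<in> V j" by blast
    then have *: "e i = e j" "f i p = f j q" using eq \<phi>[OF ij(1,2)] \<phi>[OF ij(3,4)] by simp_all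
    then have "i = j" using inj_onD[OF bij_betw_imp_inj_on[OF e]] ij by blast
    then show "p = q" using inj_onD[OF bij_betw_imp_inj_on[OF f[OF ij(1)]]] ij * by blast
  qed
  have eS: "e ` {1..k} = S" using e by (simp add: bij_betw_def)
  \<comment> \<open>Stated for a general family \<open>U\<close> and length \<open>m\<close>, to be
    used with \<open>V\<close>, \<open>h\<close> and with \<open>W\<close>,
    \<open>g\<close>.\<close>
  have sets: "\<phi> ` (\<Union>i\<in>{1..k}. U i) = S \<times> {..<m}" "(`) \<phi> ` U ` {1..k} = fibres S m"
    if U: "\<And>i. i \<in> {1..k} \<Longrightarrow> \<phi> ` U i = {e i} \<times> {..<m}" for U m
  proof -
    have "\<phi> ` (\<Union>i\<in>{1..k}. U i) = (\<Union>i\<in>{1..k}. {e i} \<times> {..<m})"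
      unfolding image_UN using U by (intro SUP_cong) auto
    then show "\<phi> ` (\<Union>i\<in>{1..k}. U i) = S \<times> {..<m}" using eS by auto
    have "(`) \<phi> ` U ` {1..k} = (\<lambda>i. {e i} \<times> {..<m}) ` {1..k}"
      unfolding image_image using U by (intro image_cong) auto
    then show "(`) \<phi> ` U ` {1..k} = fibres S m"
      unfolding fibres_def eS[symmetric] by (simp add: image_image)
  qed
  have "(\<Union>i\<in>{1..k}. W i) \<subseteq> (\<Union>i\<in>{1..k}. V i)" using WV by (rule UN_mono[OF subset_refl])
  then have injW: "inj_on \<phi> (\<Union>i\<in>{1..k}. W i)" using inj inj_on_subset by blast
  have "kirkman_frame h k (S \<times> {..<h}) (fibres S h) ((`) \<phi> ` B)"
    using kirkman_frame_image[OF fr inj] sets[of V h] \<phi>V by simp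
  moreover have "gdd3 g k (S \<times> {..<g}) (fibres S g) ((`) \<phi> ` A)"
    using gdd3_image[OF gdd injW] sets[of W g] \<phi>W by simp
  moreover have "(`) \<phi> ` A \<subseteq> (`) \<phi> ` B" using AB by (rule image_mono)
  ultimately show ?thesis by (intro exI conjI)
qed

section \<open>Counting blocks through a point and classes with a given hole\<close>

text \<open>Counting the pairs through a point \<open>p\<close>: the blocks through \<open>p\<close>, with \<open>p\<close> removed, partition
  the points outside the fibre of \<open>p\<close> into pairs.\<close>

lemma card_blocks_through_point:
  assumes gdd: "gdd3 h u (S \<times> {..<h}) (fibres S h) B" and h: "h > 0"
    and p: "p \<in> S \<times> {..<h}"
  shows "2 * card {b \<in> B. p \<in> b} = (u - 1) * h"
proof -
  have S: "finite S" "card S = u" "\<And>b. b \<in> B \<Longrightarrow> b \<subseteq> S \<times> {..<h} \<and> card b = 3 \<and> inj_on fst b"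
    "\<And>p q. p \<in> S \<times> {..<h} \<Longrightarrow> q \<in> S \<times> {..<h} \<Longrightarrow> fst p \<noteq> fst q \<Longrightarrow> (\<exists>!b. b \<in> B \<and> p \<in> b \<and> q \<in> b)"
    using gdd unfolding gdd3_fibres_iff[OF h] by blast+
  let ?B = "{b \<in> B. p \<in> b}"
  have "B \<subseteq> Pow (S \<times> {..<h})" using S(3) by auto
  then have finB: "finite B" using S(1) by (meson finite_Pow_iff finite_SigmaI finite_lessThan finite_subset)
  have eq: "(\<Union>b\<in>?B. b - {p}) = (S - {fst p}) \<times> {..<h}"
  proof (intro equalityI subsetI)
    fix q assume "q \<in> (\<Union>b\<in>?B. b - {p})"
    then obtain b where b: "b \<in> B" "p \<in> b" "q \<in> b" "q \<noteq> p" by auto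
    then have "fst q \<noteq> fst p" using S(3) by (auto dest: inj_onD)
    then show "q \<in> (S - {fst p}) \<times> {..<h}" using b S(3)[of b] by (auto simp: mem_Times_iff)
  next
    fix q assume "q \<in> (S - {fst p}) \<times> {..<h}"
    then have q: "q \<in> S \<times> {..<h}" "fst p \<noteq> fst q" by auto
    then obtain b where "b \<in> B" "p \<in> b" "q \<in> b" using S(4)[OF p q] by blast
    then show "q \<in> (\<Union>b\<in>?B. b - {p})" using q by auto
  qed
  have fin: "finite b" if "b \<in> B" for b using S(3)[OF that] by (metis card.infinite zero_neq_numeral)
  \<comment> \<open>A common second point \<open>q\<close> lies in another fibre than
    \<open>p\<close>, because blocks are transversal; then two blocks would contain the pair
    \<open>p\<close>, \<open>q\<close>.\<close>
  have disj: "(b - {p}) \<inter> (c - {p}) = {}" if "b \<in> ?B" "c \<in> ?B" "b \<noteq> c" for b c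
  proof (rule ccontr)
    assume "(b - {p}) \<inter> (c - {p}) \<noteq> {}"
    then obtain q where q: "q \<in> b" "q \<in> c" "q \<noteq> p" by blast
    have "fst p \<noteq> fst q" using q that S(3)[of b] by (auto dest: inj_onD)
    moreover have "q \<in> S \<times> {..<h}" using q that S(3)[of b] by auto
    ultimately show False using S(4)[OF p, of q] q that by blast
  qed
  have "card (\<Union>b\<in>?B. b - {p}) = (\<Sum>b\<in>?B. card (b - {p}))"
    using finB fin disj by (intro card_UN_disjoint) auto
  also have "\<dots> = (\<Sum>b\<in>?B. 2)"
    using S(3) fin by (intro sum.cong) (auto simp: card_Diff_singleton)
  finally have "2 * card ?B = card ((S - {fst p}) \<times> {..<h})" unfolding eq by simp
  moreover have "card (S - {fst p}) = u - 1" using S p by (auto simp: card_Diff_singleton)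
  ultimately show ?thesis by (simp add: card_cartesian_product)
qed

text \<open>A point over \<open>y\<close> lies in exactly one block of each class with hole other
  than \<open>y\<close> and in no block of the remaining classes. Hence the classes of the first
  kind are as many as the blocks through the point, namely \<open>g * (u - 1)\<close>, and the
  number \<open>r\<close> of classes with hole \<open>y\<close> is the same for all
  \<open>y\<close>. Summing over the holes gives \<open>u * r = r + g * (u - 1)\<close>, so
  \<open>r = g\<close> since \<open>u > 1\<close>.\<close>

lemma card_classes_with_hole:
  assumes gdd: "gdd3 (2 * g) u (S \<times> {..<2 * g}) (fibres S (2 * g)) B" and g: "g > 0" and u: "u > 1"
    and P: "partition_on B P"
    and hole: "\<And>C. C \<in> P \<Longrightarrow> hole C \<in> S \<and> partition_on ((S - {hole C}) \<times> {..<2 * g}) C"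
    and x: "x \<in> S"
  shows "card {C \<in> P. hole C = x} = g"
proof -
  have h: "2 * g > 0" using g by simp
  have S: "finite S" "card S = u" and BS: "B \<subseteq> Pow (S \<times> {..<2 * g})"
    using gdd unfolding gdd3_fibres_iff[OF h] by blast+
  have finB: "finite B" using S(1) BS by (meson finite_Pow_iff finite_SigmaI finite_lessThan finite_subset)
  have finP: "finite P" using P finB by (rule finite_elements[rotated])
  let ?r = "\<lambda>x. card {C \<in> P. hole C = x}"
  have r: "card P = ?r y + g * (u - 1)" if y: "y \<in> S" for y
  proof -
    \<comment> \<open>A representative of the fibre over \<open>y\<close>; it exists because
      \<open>g > 0\<close>.\<close>
    let ?p = "(y, 0::nat)"
    let ?B = "{b \<in> B. ?p \<in> b}"
    have p: "?p \<in> S \<times> {..<2 * g}" using y g by auto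
    have cB: "card ?B = g * (u - 1)" using card_blocks_through_point[OF gdd h p] by simp
    have cls: "\<exists>!b. b \<in> C \<and> ?p \<in> b" if "C \<in> P" "hole C \<noteq> y" for C
    proof -
      have pt: "partition_on ((S - {hole C}) \<times> {..<2 * g}) C" using hole that by blast
      have "?p \<in> (S - {hole C}) \<times> {..<2 * g}" using that p by auto
      then show ?thesis using pt
        by (auto simp: partition_on_def disjoint_def)
    qed
    have nocls: "?p \<notin> b" if "C \<in> P" "hole C = y" "b \<in> C" for C b
    proof -
      have "b \<subseteq> (S - {y}) \<times> {..<2 * g}" using hole[OF that(1)] that by (auto simp: partition_on_def)
      then show ?thesis by auto
    qed
    \<comment> \<open>A class is sent to its block through \<open>?p\<close>; the inverse sends a
      block to the class containing it.\<close>
    have "bij_betw (\<lambda>C. THE b. b \<in> C \<and> ?p \<in> b) {C \<in> P. hole C \<noteq> y} ?B"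
      unfolding bij_betw_def
    proof
      have the: "(THE b. b \<in> C \<and> ?p \<in> b) \<in> C" "?p \<in> (THE b. b \<in> C \<and> ?p \<in> b)"
        if "C \<in> P" "hole C \<noteq> y" for C
        using theI'[OF cls[OF that]] by auto
      have PD: "C = D" if "C \<in> P" "D \<in> P" "b \<in> C" "b \<in> D" for C D b
        using that P by (auto simp: partition_on_def disjoint_def)
      show "inj_on (\<lambda>C. THE b. b \<in> C \<and> ?p \<in> b) {C \<in> P. hole C \<noteq> y}"
      proof (rule inj_onI)
        fix C D assume "C \<in> {C \<in> P. hole C \<noteq> y}" "D \<in> {C \<in> P. hole C \<noteq> y}"
          "(THE b. b \<in> C \<and> ?p \<in> b) = (THE b. b \<in> D \<and> ?p \<in> b)"
        then show "C = D" using the[of C] the[of D] PD by auto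
      qed
      have UP: "\<Union>P = B" using P by (simp add: partition_on_def)
      show "(\<lambda>C. THE b. b \<in> C \<and> ?p \<in> b) ` {C \<in> P. hole C \<noteq> y} = ?B"
      proof (intro equalityI subsetI)
        fix b assume "b \<in> (\<lambda>C. THE b. b \<in> C \<and> ?p \<in> b) ` {C \<in> P. hole C \<noteq> y}"
        then show "b \<in> ?B" using the UP by blast
      next
        fix b assume b: "b \<in> ?B"
        then obtain C where C: "C \<in> P" "b \<in> C" using UP by auto
        then have hC: "hole C \<noteq> y" using nocls b by blast
        have "(THE b. b \<in> C \<and> ?p \<in> b) = b"
          using the1_equality[OF cls[OF C(1) hC]] C b by blast
        then show "b \<in> (\<lambda>C. THE b. b \<in> C \<and> ?p \<in> b) ` {C \<in> P. hole C \<noteq> y}"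
          using C hC by force
      qed
    qed
    then have "card {C \<in> P. hole C \<noteq> y} = g * (u - 1)" using cB by (simp add: bij_betw_same_card)
    moreover have "card P = ?r y + card {C \<in> P. hole C \<noteq> y}"
      using finP by (subst card_Un_disjoint[symmetric]) (auto intro: arg_cong[where f = card])
    ultimately show ?thesis by simp
  qed
  have "card P = (\<Sum>y\<in>S. ?r y)"
  proof -
    have "card P = card (\<Union>y\<in>S. {C \<in> P. hole C = y})"
      using hole by (intro arg_cong[where f = card]) auto
    also have "\<dots> = (\<Sum>y\<in>S. ?r y)" using S finP by (intro card_UN_disjoint) auto
    finally show ?thesis .
  qed
  also have "\<dots> = (\<Sum>y\<in>S. ?r x)"
  proof (rule sum.cong)
    show "?r y = ?r x" if "y \<in> S" for y using r[OF that] r[OF x] by simp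
  qed simp
  finally have "card P = u * ?r x" using S by simp
  then have "u * ?r x = ?r x + g * (u - 1)" using r[OF x] by simp
  \<comment> \<open>With \<open>u = Suc w\<close> the equation reduces to
    \<open>w * r = w * g\<close>, and the positive factor \<open>w\<close> cancels.\<close>
  moreover obtain w where "u = Suc w" "w > 0" using u by (cases u) auto
  ultimately show ?thesis by simp
qed

section \<open>Resolutions as block colourings\<close>

text \<open>Resolutions are encoded as colourings of the blocks, with the pair \<open>(x, j)\<close> the \<open>j\<close>-th class
  whose hole is the fibre of \<open>x\<close>.\<close>

definition frame_colouring ::
  "nat \<Rightarrow> 'i set \<Rightarrow> ('i \<times> nat) set set \<Rightarrow> (('i \<times> nat) set \<Rightarrow> 'i \<times> nat) \<Rightarrow> bool" where
  "frame_colouring g S B c \<longleftrightarrow> c ` B \<subseteq> S \<times> {..<g} \<and>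
     (\<forall>x\<in>S. \<forall>j<g. partition_on ((S - {x}) \<times> {..<2 * g}) {b \<in> B. c b = (x, j)})"

text \<open>A block is coloured by the hole of its class and the number of that class among those
  with the same hole. There are \<open>g\<close> of these for every hole, whatever
  \<open>u > 1\<close> is, so ingredients of different sizes use the same numbers.\<close>

lemma frame_colouring_exists:
  assumes fr: "kirkman_frame (2 * g) u (S \<times> {..<2 * g}) (fibres S (2 * g)) B" and g: "g > 0" and u: "u > 1"
  shows "\<exists>c. frame_colouring g S B c"
proof -
  obtain P where gdd: "gdd3 (2 * g) u (S \<times> {..<2 * g}) (fibres S (2 * g)) B"
    and P: "partition_on B P"
    and C: "\<And>C. C \<in> P \<Longrightarrow> \<exists>G\<in>fibres S (2 * g). partition_on (S \<times> {..<2 * g} - G) C"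
    using fr unfolding kirkman_frame_def by blast
  have "\<exists>x. x \<in> S \<and> partition_on ((S - {x}) \<times> {..<2 * g}) C" if "C \<in> P" for C
  proof -
    from C[OF that] obtain x
      where x: "x \<in> S" "partition_on (S \<times> {..<2 * g} - {x} \<times> {..<2 * g}) C"
      by (auto simp: fibres_def)
    moreover have "S \<times> {..<2 * g} - {x} \<times> {..<2 * g} = (S - {x}) \<times> {..<2 * g}" by auto
    ultimately show ?thesis by auto
  qed
  then obtain hole where hole: "\<And>C. C \<in> P \<Longrightarrow> hole C \<in> S \<and> partition_on ((S - {hole C}) \<times> {..<2 * g}) C"
    by metis
  have crd: "card {C \<in> P. hole C = x} = g" if "x \<in> S" for x
    using card_classes_with_hole[OF gdd g u P hole that] .
  \<comment> \<open>A set of positive cardinality \<open>g\<close> is finite, hence can be numbered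
    by \<open>{..<g}\<close>.\<close>
  have "\<exists>n. bij_betw n {C \<in> P. hole C = x} {..<g}" if "x \<in> S" for x
    using crd[OF that] g by (metis card_ge_0_finite card_lessThan finite_lessThan finite_same_card_bij)
  then obtain n where n: "\<And>x. x \<in> S \<Longrightarrow> bij_betw (n x) {C \<in> P. hole C = x} {..<g}" by metis
  have "\<exists>C. C \<in> P \<and> b \<in> C" if "b \<in> B" for b using P that by (auto simp: partition_on_def)
  then obtain cl where cl: "\<And>b. b \<in> B \<Longrightarrow> cl b \<in> P \<and> b \<in> cl b" by metis
  have cl_eq: "cl b = C" if "C \<in> P" "b \<in> C" for b C
  proof -
    have "b \<in> B" using that P by (auto simp: partition_on_def)
    then show ?thesis using cl that P unfolding partition_on_def disjoint_def by blast
  qed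
  define c where "c b = (hole (cl b), n (hole (cl b)) (cl b))" for b
  have "c ` B \<subseteq> S \<times> {..<g}"
  proof
    fix z assume "z \<in> c ` B"
    then obtain b where b: "b \<in> B" "z = c b" by auto
    then show "z \<in> S \<times> {..<g}"
      using cl[OF b(1)] hole[of "cl b"] n[of "hole (cl b)"] by (auto simp: c_def bij_betw_def)
  qed
  moreover have "partition_on ((S - {x}) \<times> {..<2 * g}) {b \<in> B. c b = (x, j)}" if "x \<in> S" "j < g" for x j
  proof -
    have "j \<in> n x ` {C \<in> P. hole C = x}" using n[OF that(1)] that by (auto simp: bij_betw_def)
    then obtain C where C: "C \<in> P" "hole C = x" "j = n x C" by auto
    \<comment> \<open>Equal first components give equal holes, and \<open>n x\<close> is injective
      on the classes with hole \<open>x\<close>; so a colour determines the class.\<close>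
    have "{b \<in> B. c b = (x, j)} = C"
    proof (intro equalityI subsetI)
      fix b assume "b \<in> {b \<in> B. c b = (x, j)}"
      then have b: "b \<in> B" "hole (cl b) = x" "n x (cl b) = n x C" using C by (auto simp: c_def)
      have "cl b \<in> {C \<in> P. hole C = x}" "C \<in> {C \<in> P. hole C = x}" using b C cl by auto
      then have "cl b = C" using n[OF that(1)] b(3) unfolding bij_betw_def by (meson inj_onD)
      then show "b \<in> C" using cl b by auto
    next
      fix b assume b: "b \<in> C"
      then have "b \<in> B" using C P by (auto simp: partition_on_def)
      then show "b \<in> {b \<in> B. c b = (x, j)}" using cl_eq[OF C(1) b] C by (auto simp: c_def)
    qed
    then show ?thesis using hole[OF C(1)] C by auto
  qed
  ultimately show ?thesis unfolding frame_colouring_def by blast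
qed

lemma kirkman_frame_of_colouring:
  assumes gdd: "gdd3 (2 * g) u (S \<times> {..<2 * g}) (fibres S (2 * g)) B"
    and c: "frame_colouring g S B c"
  shows "kirkman_frame (2 * g) u (S \<times> {..<2 * g}) (fibres S (2 * g)) B"
proof -
  \<comment> \<open>Only attained colours are taken, which keeps empty classes out of the
    partition.\<close>
  let ?P = "(\<lambda>z. {b \<in> B. c b = z}) ` (c ` B)"
  have "partition_on B ?P" by (intro partition_onI) (auto simp: disjnt_def)
  moreover have "\<exists>G\<in>fibres S (2 * g). partition_on (S \<times> {..<2 * g} - G) C" if "C \<in> ?P" for C
  proof -
    from that obtain b where b: "b \<in> B" "C = {d \<in> B. c d = c b}" by auto
    obtain x j where xj: "c b = (x, j)" by force
    then have "(x, j) \<in> S \<times> {..<g}" using c b(1) unfolding frame_colouring_def by force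
    then have x: "x \<in> S" "partition_on ((S - {x}) \<times> {..<2 * g}) C"
      using c b xj unfolding frame_colouring_def by auto
    moreover have "S \<times> {..<2 * g} - {x} \<times> {..<2 * g} = (S - {x}) \<times> {..<2 * g}" by auto
    moreover have "{x} \<times> {..<2 * g} \<in> fibres S (2 * g)" using x(1) by (simp add: fibres_def)
    ultimately show ?thesis by metis
  qed
  ultimately show ?thesis using gdd unfolding kirkman_frame_def by blast
qed

section \<open>Gluing the ingredients along the blocks of the PBD\<close>

text \<open>Points over distinct \<open>x\<close> and \<open>y\<close> can meet only in the
  ingredient over the unique PBD block through \<open>x\<close> and \<open>y\<close>, and there they
  meet exactly once. The group size \<open>h\<close> is left open, so that the frames and their
  subdesigns are glued alike.\<close>

lemma gdd3_glue:
  assumes h: "h > 0" and X: "finite X"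
    and sub: "\<And>\<beta>. \<beta> \<in> Q \<Longrightarrow> \<beta> \<subseteq> X"
    and pair: "\<And>x y. x \<in> X \<Longrightarrow> y \<in> X \<Longrightarrow> x \<noteq> y \<Longrightarrow> \<exists>!\<beta>. \<beta> \<in> Q \<and> x \<in> \<beta> \<and> y \<in> \<beta>"
    and F: "\<And>\<beta>. \<beta> \<in> Q \<Longrightarrow> gdd3 h (card \<beta>) (\<beta> \<times> {..<h}) (fibres \<beta> h) (F \<beta>)"
  shows "gdd3 h (card X) (X \<times> {..<h}) (fibres X h) (\<Union>\<beta>\<in>Q. F \<beta>)"
proof -
  have blk: "b \<subseteq> \<beta> \<times> {..<h} \<and> card b = 3 \<and> inj_on fst b" if "\<beta> \<in> Q" "b \<in> F \<beta>" for \<beta> b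
    using F[OF that(1)] that unfolding gdd3_fibres_iff[OF h] by blast
  have ex: "\<exists>!b. b \<in> F \<beta> \<and> p \<in> b \<and> q \<in> b"
    if "\<beta> \<in> Q" "p \<in> \<beta> \<times> {..<h}" "q \<in> \<beta> \<times> {..<h}" "fst p \<noteq> fst q" for \<beta> p q
    using F[OF that(1)] that unfolding gdd3_fibres_iff[OF h] by blast
  have "\<exists>!b. b \<in> (\<Union>\<beta>\<in>Q. F \<beta>) \<and> p \<in> b \<and> q \<in> b"
    if pq: "p \<in> X \<times> {..<h}" "q \<in> X \<times> {..<h}" "fst p \<noteq> fst q" for p q
  proof -
    have "fst p \<in> X" "fst q \<in> X" using pq by auto
    from pair[OF this pq(3)] obtain \<beta> where \<beta>: "\<beta> \<in> Q" "fst p \<in> \<beta>" "fst q \<in> \<beta>"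
      and u\<beta>: "\<And>\<gamma>. \<gamma> \<in> Q \<Longrightarrow> fst p \<in> \<gamma> \<Longrightarrow> fst q \<in> \<gamma> \<Longrightarrow> \<gamma> = \<beta>" by blast
    have "p \<in> \<beta> \<times> {..<h}" "q \<in> \<beta> \<times> {..<h}" using pq \<beta> by (auto simp: mem_Times_iff)
    from ex[OF \<beta>(1) this pq(3)] obtain b where b: "b \<in> F \<beta>" "p \<in> b" "q \<in> b"
      and ub: "\<And>d. d \<in> F \<beta> \<Longrightarrow> p \<in> d \<Longrightarrow> q \<in> d \<Longrightarrow> d = b" by blast
    show ?thesis
    proof (rule ex1I[of _ b])
      show "b \<in> (\<Union>\<beta>\<in>Q. F \<beta>) \<and> p \<in> b \<and> q \<in> b" using b \<beta> by auto
      fix d assume d: "d \<in> (\<Union>\<beta>\<in>Q. F \<beta>) \<and> p \<in> d \<and> q \<in> d"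
      then obtain \<gamma> where \<gamma>: "\<gamma> \<in> Q" "d \<in> F \<gamma>" by auto
      \<comment> \<open>A block of the ingredient over \<open>\<gamma>\<close> lies over
        \<open>\<gamma>\<close>, so \<open>\<gamma>\<close> contains both first coordinates.\<close>
      then have "p \<in> \<gamma> \<times> {..<h}" "q \<in> \<gamma> \<times> {..<h}" using blk[OF \<gamma>] d by auto
      then have "\<gamma> = \<beta>" using u\<beta> \<gamma> by (auto simp: mem_Times_iff)
      then show "d = b" using ub \<gamma> d by auto
    qed
  qed
  moreover have "b \<subseteq> X \<times> {..<h} \<and> card b = 3 \<and> inj_on fst b" if "b \<in> (\<Union>\<beta>\<in>Q. F \<beta>)" for b
  proof -
    from that obtain \<beta> where \<beta>: "\<beta> \<in> Q" "b \<in> F \<beta>" by blast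
    show ?thesis using blk[OF \<beta>] sub[OF \<beta>(1)] by blast
  qed
  ultimately show ?thesis
    unfolding gdd3_fibres_iff[OF h] using X by (intro conjI ballI impI refl) simp_all
qed

text \<open>The PBD blocks through \<open>x\<close>, with \<open>x\<close> removed, partition the
  other points of \<open>X\<close>. The classes coloured \<open>(x, j)\<close> in the ingredients
  over these blocks therefore cover disjoint regions that fill everything outside the fibre of
  \<open>x\<close>.\<close>

lemma frame_colouring_glue:
  assumes g: "g > 0" and X: "finite X"
    and sub: "\<And>\<beta>. \<beta> \<in> Q \<Longrightarrow> \<beta> \<subseteq> X"
    and pair: "\<And>x y. x \<in> X \<Longrightarrow> y \<in> X \<Longrightarrow> x \<noteq> y \<Longrightarrow> \<exists>!\<beta>. \<beta> \<in> Q \<and> x \<in> \<beta> \<and> y \<in> \<beta>"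
    and F: "\<And>\<beta>. \<beta> \<in> Q \<Longrightarrow> gdd3 (2 * g) (card \<beta>) (\<beta> \<times> {..<2 * g}) (fibres \<beta> (2 * g)) (F \<beta>)"
    and c: "\<And>\<beta>. \<beta> \<in> Q \<Longrightarrow> frame_colouring g \<beta> (F \<beta>) (c \<beta>)"
  shows "\<exists>d. frame_colouring g X (\<Union>\<beta>\<in>Q. F \<beta>) d"
proof -
  have h: "2 * g > 0" using g by simp
  have blk: "b \<subseteq> \<beta> \<times> {..<2 * g} \<and> card b = 3 \<and> inj_on fst b" if "\<beta> \<in> Q" "b \<in> F \<beta>" for \<beta> b
    using F[OF that(1)] that unfolding gdd3_fibres_iff[OF h] by blast
  \<comment> \<open>A block of three points with distinct first coordinates determines two points of
    \<open>X\<close>, and thereby the PBD block it came from. So the colour of a glued block can be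
    read off in its only ingredient.\<close>
  have host: "\<beta> = \<gamma>" if "\<beta> \<in> Q" "\<gamma> \<in> Q" "b \<in> F \<beta>" "b \<in> F \<gamma>" for \<beta> \<gamma> b
  proof -
    have b: "b \<subseteq> \<beta> \<times> {..<2 * g}" "b \<subseteq> \<gamma> \<times> {..<2 * g}" "card b = 3" "inj_on fst b"
      using blk that by blast+
    then obtain p q where pq: "p \<in> b" "q \<in> b" "p \<noteq> q"
      by (metis card_3_iff insertCI)
    then have "fst p \<noteq> fst q" using b(4) by (auto dest: inj_onD)
    moreover have "fst p \<in> \<beta>" "fst q \<in> \<beta>" "fst p \<in> \<gamma>" "fst q \<in> \<gamma>" using pq b by auto
    moreover have "\<beta> \<subseteq> X" using sub that by blast
    ultimately show ?thesis using pair[of "fst p" "fst q"] that by blast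
  qed
  have "\<exists>\<beta>. \<beta> \<in> Q \<and> b \<in> F \<beta>" if "b \<in> (\<Union>\<beta>\<in>Q. F \<beta>)" for b using that by auto
  then obtain H where H: "\<And>b. b \<in> (\<Union>\<beta>\<in>Q. F \<beta>) \<Longrightarrow> H b \<in> Q \<and> b \<in> F (H b)" by metis
  have H_eq: "H b = \<beta>" if "\<beta> \<in> Q" "b \<in> F \<beta>" for b \<beta>
  proof -
    have "b \<in> (\<Union>\<beta>\<in>Q. F \<beta>)" using that by auto
    then show ?thesis using H host that by metis
  qed
  define d where "d b = c (H b) b" for b
  have d: "d b = c \<beta> b" if "\<beta> \<in> Q" "b \<in> F \<beta>" for b \<beta> using H_eq that by (simp add: d_def)
  have crange: "c \<beta> b \<in> \<beta> \<times> {..<g}" if "\<beta> \<in> Q" "b \<in> F \<beta>" for b \<beta>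
    using c[OF that(1)] that(2) unfolding frame_colouring_def by blast
  have "d ` (\<Union>\<beta>\<in>Q. F \<beta>) \<subseteq> X \<times> {..<g}"
  proof
    fix z assume "z \<in> d ` (\<Union>\<beta>\<in>Q. F \<beta>)"
    then obtain \<beta> b where \<beta>: "\<beta> \<in> Q" "b \<in> F \<beta>" "z = d b" by blast
    then have "z \<in> \<beta> \<times> {..<g}" using d crange by simp
    then show "z \<in> X \<times> {..<g}" using sub[OF \<beta>(1)] by blast
  qed
  moreover have "partition_on ((X - {x}) \<times> {..<2 * g}) {b \<in> (\<Union>\<beta>\<in>Q. F \<beta>). d b = (x, j)}"
    if x: "x \<in> X" and j: "j < g" for x j
  proof -
    let ?C = "\<lambda>\<beta>. {b \<in> F \<beta>. c \<beta> b = (x, j)}"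
    let ?Q = "{\<beta> \<in> Q. x \<in> \<beta>}"
    have pC: "partition_on ((\<beta> - {x}) \<times> {..<2 * g}) (?C \<beta>)" if "\<beta> \<in> ?Q" for \<beta>
      using c that j unfolding frame_colouring_def by blast
    \<comment> \<open>Colours over \<open>\<beta>\<close> have their first component in
      \<open>\<beta>\<close>, so PBD blocks avoiding \<open>x\<close> contribute nothing to the
      colour \<open>(x, j)\<close>.\<close>
    have classes: "{b \<in> (\<Union>\<beta>\<in>Q. F \<beta>). d b = (x, j)} = (\<Union>\<beta>\<in>?Q. ?C \<beta>)"
    proof (intro equalityI subsetI)
      fix b assume "b \<in> {b \<in> (\<Union>\<beta>\<in>Q. F \<beta>). d b = (x, j)}"
      then obtain \<beta> where \<beta>: "\<beta> \<in> Q" "b \<in> F \<beta>" "d b = (x, j)" by auto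
      then have "c \<beta> b = (x, j)" using d by auto
      moreover from this have "x \<in> \<beta>" using crange[OF \<beta>(1,2)] by auto
      ultimately show "b \<in> (\<Union>\<beta>\<in>?Q. ?C \<beta>)" using \<beta> by auto
    qed (use d in auto)
    have points: "(\<Union>\<beta>\<in>?Q. (\<beta> - {x}) \<times> {..<2 * g}) = (X - {x}) \<times> {..<2 * g}"
    proof (intro equalityI subsetI)
      fix p assume "p \<in> (X - {x}) \<times> {..<2 * g}"
      then obtain y i where y: "p = (y, i)" "y \<in> X" "y \<noteq> x" "i < 2 * g" by auto
      then obtain \<beta> where "\<beta> \<in> Q" "x \<in> \<beta>" "y \<in> \<beta>" using pair[OF x y(2)] by blast
      then show "p \<in> (\<Union>\<beta>\<in>?Q. (\<beta> - {x}) \<times> {..<2 * g})" using y by auto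
    qed (use sub in auto)
    \<comment> \<open>A point over a common \<open>y \<noteq> x\<close> would put the pair
      \<open>x\<close>, \<open>y\<close> into two PBD blocks.\<close>
    have disj: "((\<beta> - {x}) \<times> {..<2 * g}) \<inter> ((\<gamma> - {x}) \<times> {..<2 * g}) = {}"
      if "\<beta> \<in> ?Q" "\<gamma> \<in> ?Q" "\<beta> \<noteq> \<gamma>" for \<beta> \<gamma>
    proof (rule ccontr)
      assume "((\<beta> - {x}) \<times> {..<2 * g}) \<inter> ((\<gamma> - {x}) \<times> {..<2 * g}) \<noteq> {}"
      then obtain y where y: "y \<in> \<beta>" "y \<in> \<gamma>" "y \<noteq> x" by auto
      then have "y \<in> X" using sub that by blast
      then show False using pair[OF x, of y] y that by blast
    qed
    show ?thesis unfolding classes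
    proof (rule partition_onI)
      show "\<Union> (\<Union>\<beta>\<in>?Q. ?C \<beta>) = (X - {x}) \<times> {..<2 * g}"
      proof -
        have "\<Union> (\<Union>\<beta>\<in>?Q. ?C \<beta>) = (\<Union>\<beta>\<in>?Q. \<Union> (?C \<beta>))" by blast
        also have "\<dots> = (\<Union>\<beta>\<in>?Q. (\<beta> - {x}) \<times> {..<2 * g})"
          using partition_onD1[OF pC] by (intro SUP_cong) auto
        finally show ?thesis using points by simp
      qed
      show "{} \<notin> (\<Union>\<beta>\<in>?Q. ?C \<beta>)" using partition_onD3[OF pC] by blast
      show "disjnt b b'" if b: "b \<in> (\<Union>\<beta>\<in>?Q. ?C \<beta>)" "b' \<in> (\<Union>\<beta>\<in>?Q. ?C \<beta>)" "b \<noteq> b'" for b b'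
      proof -
        obtain \<beta> \<gamma> where bc: "\<beta> \<in> ?Q" "b \<in> ?C \<beta>" "\<gamma> \<in> ?Q" "b' \<in> ?C \<gamma>" using b by blast
        show ?thesis
        proof (cases "\<beta> = \<gamma>")
          case True
          then show ?thesis using partition_onD2[OF pC[OF bc(1)]] bc b(3)
            by (auto simp: disjoint_def disjnt_def)
        next
          case False
          have "b \<subseteq> (\<beta> - {x}) \<times> {..<2 * g}" "b' \<subseteq> (\<gamma> - {x}) \<times> {..<2 * g}"
            using partition_onD1[OF pC[OF bc(1)]] partition_onD1[OF pC[OF bc(3)]] bc by blast+
          then show ?thesis using disj[OF bc(1,3) False] unfolding disjnt_def by blast
        qed
      qed
    qed
  qed
  ultimately show ?thesis unfolding frame_colouring_def by blast
qed

section \<open>Back to natural numbers as points, and the conclusion\<close>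

text \<open>\<open>prod_encode\<close> turns the pairs into natural numbers and \<open>e\<close>
  enumerates the groups. Both designs use the same enumeration, so \<open>g \<le> h\<close> alone
  puts each small group inside the large group with the same index.\<close>

lemma nested_kirkman_frame_exists_of_fibres:
  assumes g: "g > 0" "h > 0" and X: "finite (X :: nat set)"
    and fr: "kirkman_frame h (card X) (X \<times> {..<h}) (fibres X h) B"
    and gdd: "gdd3 g (card X) (X \<times> {..<g}) (fibres X g) A" and AB: "A \<subseteq> B" and gh: "g \<le> h"
  shows "nested_kirkman_frame_exists g h (card X)"
proof -
  let ?u = "card X"
  obtain e where e: "bij_betw e {1..?u} X"
    using X by (metis card_atLeastAtMost diff_Suc_1 finite_atLeastAtMost finite_same_card_bij)
  then have eX: "e ` {1..?u} = X" and inje: "inj_on e {1..?u}" by (auto simp: bij_betw_def)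
  let ?V = "\<lambda>m i. prod_encode ` ({e i} \<times> {..<m})"
  have injp: "inj_on prod_encode Y" for Y by (rule inj_prod_encode)
  have un: "(\<Union>i\<in>{1..?u}. ?V m i) = prod_encode ` (X \<times> {..<m})" for m
  proof -
    have "(\<Union>i\<in>{1..?u}. ?V m i) = prod_encode ` (e ` {1..?u} \<times> {..<m})" by blast
    then show ?thesis by (simp only: eX)
  qed
  have im: "?V m ` {1..?u} = (`) prod_encode ` fibres X m" for m
  proof -
    have "?V m ` {1..?u} = (`) prod_encode ` fibres (e ` {1..?u}) m"
      by (simp only: fibres_def image_image)
    then show ?thesis by (simp only: eX)
  qed
  have inj: "inj_on (?V m) {1..?u}" if "m > 0" for m
  proof (rule inj_onI)
    fix i j assume ij: "i \<in> {1..?u}" "j \<in> {1..?u}" "?V m i = ?V m j"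
    then have "{e i} \<times> {..<m} = {e j} \<times> {..<m}" by (simp add: inj_image_eq_iff[OF inj_prod_encode])
    then have "e i = e j" using that by (auto simp: set_eq_iff)
    then show "i = j" using inje ij by (auto dest: inj_onD)
  qed
  have "nested_kirkman_frame g h ?u (?V h) ((`) prod_encode ` B) (?V g) ((`) prod_encode ` A)"
    unfolding nested_kirkman_frame_def un unfolding im
    using kirkman_frame_image[OF fr injp] gdd3_image[OF gdd injp] AB gh inj g by auto
  then show ?thesis unfolding nested_kirkman_frame_exists_def by blast
qed

theorem theorem3p3:
  fixes g v :: nat and K :: "nat set"
  assumes "g > 0"
    and "\<forall>k\<in>K. k > 0"
    and "pbd_exists v K"
    and "\<forall>k\<in>K. nested_kirkman_frame_exists g (2 * g) k"
  shows "nested_kirkman_frame_exists g (2 * g) v"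
proof -
  obtain X :: "nat set" and R where pbd: "pbd v K X R"
    using assms(3) unfolding pbd_exists_def by blast
  then have X: "finite X" "card X = v"
    and R: "\<And>\<beta>. \<beta> \<in> R \<Longrightarrow> \<beta> \<subseteq> X \<and> card \<beta> \<in> K"
    and pairR: "\<And>x y. x \<in> X \<Longrightarrow> y \<in> X \<Longrightarrow> x \<noteq> y \<Longrightarrow> \<exists>!\<beta>. \<beta> \<in> R \<and> x \<in> \<beta> \<and> y \<in> \<beta>"
    by (simp_all add: pbd_def)
  \<comment> \<open>A frame with one group has no classes at all, rather than \<open>g\<close> of them, so singleton blocks
    have to be discarded.\<close>
  define Q where "Q = {\<beta> \<in> R. card \<beta> > 1}"
  have sub: "\<And>\<beta>. \<beta> \<in> Q \<Longrightarrow> \<beta> \<subseteq> X" using R by (auto simp: Q_def)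
  \<comment> \<open>No pair is lost by passing from \<open>R\<close> to \<open>Q\<close>: a block
    covering two distinct points has more than one point.\<close>
  have big: "card \<beta> > 1" if "\<beta> \<in> R" "x \<in> \<beta>" "y \<in> \<beta>" "x \<noteq> y" for \<beta> x y
  proof -
    have "finite \<beta>" using R[OF that(1)] X finite_subset by blast
    then have "card {x, y} \<le> card \<beta>" using that by (intro card_mono) auto
    then show ?thesis using that by simp
  qed
  have pair: "\<exists>!\<beta>. \<beta> \<in> Q \<and> x \<in> \<beta> \<and> y \<in> \<beta>" if "x \<in> X" "y \<in> X" "x \<noteq> y" for x y
    using pairR[OF that] big that(3) unfolding Q_def by blast
  have "\<exists>B A. kirkman_frame (2 * g) (card \<beta>) (\<beta> \<times> {..<2 * g}) (fibres \<beta> (2 * g)) B \<and>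
           gdd3 g (card \<beta>) (\<beta> \<times> {..<g}) (fibres \<beta> g) A \<and> A \<subseteq> B" if "\<beta> \<in> Q" for \<beta>
    using that R assms(4) X finite_subset[OF sub[OF that]]
    by (intro nested_kirkman_frame_on_fibres) (auto simp: Q_def)
  then obtain B A
    where B: "\<And>\<beta>. \<beta> \<in> Q \<Longrightarrow> kirkman_frame (2 * g) (card \<beta>) (\<beta> \<times> {..<2 * g}) (fibres \<beta> (2 * g)) (B \<beta>)"
      and A: "\<And>\<beta>. \<beta> \<in> Q \<Longrightarrow> gdd3 g (card \<beta>) (\<beta> \<times> {..<g}) (fibres \<beta> g) (A \<beta>)"
      and AB: "\<And>\<beta>. \<beta> \<in> Q \<Longrightarrow> A \<beta> \<subseteq> B \<beta>" by metis
  have Bg: "gdd3 (2 * g) (card \<beta>) (\<beta> \<times> {..<2 * g}) (fibres \<beta> (2 * g)) (B \<beta>)" if "\<beta> \<in> Q" for \<beta>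
    using B[OF that] by (simp add: kirkman_frame_def)
  have "\<exists>c. frame_colouring g \<beta> (B \<beta>) c" if "\<beta> \<in> Q" for \<beta>
    using frame_colouring_exists[OF B[OF that] assms(1)] that by (simp add: Q_def)
  then obtain c where c: "\<And>\<beta>. \<beta> \<in> Q \<Longrightarrow> frame_colouring g \<beta> (B \<beta>) (c \<beta>)" by metis
  have h: "2 * g > 0" using assms(1) by simp
  obtain d where d: "frame_colouring g X (\<Union>\<beta>\<in>Q. B \<beta>) d"
    using frame_colouring_glue[OF assms(1) X(1) sub pair Bg c] by blast
  have "kirkman_frame (2 * g) (card X) (X \<times> {..<2 * g}) (fibres X (2 * g)) (\<Union>\<beta>\<in>Q. B \<beta>)"
    using kirkman_frame_of_colouring[OF gdd3_glue[OF h X(1) sub pair Bg] d] .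
  \<comment> \<open>The subdesigns are glued over the same \<open>Q\<close> as the frames, so their
    inclusions unite to one inclusion.\<close>
  moreover have "gdd3 g (card X) (X \<times> {..<g}) (fibres X g) (\<Union>\<beta>\<in>Q. A \<beta>)"
    using gdd3_glue[OF assms(1) X(1) sub pair A] .
  moreover have "(\<Union>\<beta>\<in>Q. A \<beta>) \<subseteq> (\<Union>\<beta>\<in>Q. B \<beta>)" using AB by blast
  ultimately show ?thesis
    using nested_kirkman_frame_exists_of_fibres[OF assms(1) h X(1)] X(2) by auto
qed

end
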